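(* Let $\mathbf{G}$ be an $\ell$-group, and suppose $|I|=|J|$ and $\lambda,\rho\colon J\to I$ are bijections. Then the kite $K_{I,J}^{\lambda,\rho}(\mathbf{G})$ is a pseudo MV-algebra.
   Context: An FL-algebra is an algebra $\langle A;\wedge,\vee,\backslash,/,\cdot,0,1\rangle$ where $\langle A;\wedge,\vee\rangle$ is a lattice, $\langle A;\cdot,1\rangle$ a monoid, $xy\le z\iff y\le x\backslash z\iff x\le z/y$, and $0\in A$. A pseudo BL-algebra is an FL-algebra with $0\le x\le 1$, $x(x\backslash(x\wedge y))=x\wedge y=((x\wedge y)/x)x$, and $x\backslash y\vee y\backslash x=1=y/x\vee x/y$. A pseudo MV-algebra is a pseudo BL-algebra satisfying $x/(y\backslash x)=x\vee y=(x/y)\backslash x$. Kites. Let $\mathbf{G}$ be an $\ell$-group (written multiplicatively, identity $e$), $G^+=\{g: g\ge e\}$, $G^-=\{g: g\le e\}$. Let $I,J$ be sets with $|J|\le|I|$ and $\lambda,\rho\colon J\to I$ injections. The kite $K_{I,J}^{\lambda,\rho}(\mathbf{G})$ is the algebra $\langle (G^+)^J\uplus(G^-)^I;\vee,\wedge,\cdot,\backslash,/,1,0\rangle$ (disjoint union) whose order is coordinatewise inside $(G^+)^J$ and inside $(G^-)^I$, with every element of $(G^+)^J$ below every element of $(G^-)^I$. Elements of $(G^-)^I$ are written $\langle a_i^{-1}\rangle_{i\in I}$ with $a_i\in G^+$, elements of $(G^+)^J$ as $\langle f_j\rangle_{j\in J}$; $e^{-1}$ denotes $e$ as an element of $G^-$.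 $1$ is the constant sequence $e^{-1}$ in $(G^-)^I$ and $0$ the constant sequence $e$ in $(G^+)^J$. Multiplication: $\langle a_i^{-1}\rangle\cdot\langle b_i^{-1}\rangle=\langle (b_ia_i)^{-1}\rangle$; $\langle a_i^{-1}\rangle\cdot\langle f_j\rangle=\langle a_{\lambda(j)}^{-1}f_j\vee e\rangle_{j\in J}$; $\langle f_j\rangle\cdot\langle a_i^{-1}\rangle=\langle f_ja_{\rho(j)}^{-1}\vee e\rangle_{j\in J}$; $\langle f_j\rangle\cdot\langle g_j\rangle=0$. Divisions: $\langle a_i^{-1}\rangle\backslash\langle b_i^{-1}\rangle=\langle a_ib_i^{-1}\wedge e^{-1}\rangle$; $\langle b_i^{-1}\rangle/\langle a_i^{-1}\rangle=\langle b_i^{-1}a_i\wedge e^{-1}\rangle$; $\langle a_i^{-1}\rangle\backslash\langle f_j\rangle=\langle a_{\lambda(j)}f_j\rangle_{j}$; $\langle f_j\rangle/\langle a_i^{-1}\rangle=\langle f_ja_{\rho(j)}\rangle_{j}$; $\langle f_j\rangle\backslash\langle g_j\rangle$ is the element of $(G^-)^I$ whose $i$-th coordinate is $f_{\rho^{-1}(i)}^{-1}g_{\rho^{-1}(i)}\wedge e^{-1}$ if $i\in\rho(J)$ and $e^{-1}$ otherwise; $\langle g_j\rangle/\langle f_j\rangle$ is the element of $(G^-)^I$ whose $i$-th coordinate is $g_{\lambda^{-1}(i)}f_{\lambda^{-1}(i)}^{-1}\wedge e^{-1}$ if $i\in\lambda(J)$ and $e^{-1}$ otherwise; $\langle a_i^{-1}\rangle/\langle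 f_j\rangle=1=\langle f_j\rangle\backslash\langle a_i^{-1}\rangle$. *)

theory Defs
  imports "HOL-Algebra.Group" "HOL-Library.Equipollence"
begin

record 'a fl_sig = "'a monoid" +
  fl_meet :: "'a \<Rightarrow> 'a \<Rightarrow> 'a" (infixl \<open>\<^bold>\<and>\<index>\<close> 65)
  fl_join :: "'a \<Rightarrow> 'a \<Rightarrow> 'a" (infixl \<open>\<^bold>\<or>\<index>\<close> 65)
  fl_ldiv :: "'a \<Rightarrow> 'a \<Rightarrow> 'a" (infix \<open>\<setminus>\<index>\<close> 69)
  fl_rdiv :: "'a \<Rightarrow> 'a \<Rightarrow> 'a" (infix \<open>\<sslash>\<index>\<close> 69)
  fl_zero :: "'a" (\<open>\<zero>\<index>\<close>)

definition fl_le :: "('a, 'b) fl_sig_scheme \<Rightarrow> 'a \<Rightarrow> 'a \<Rightarrow> bool" (infix \<open>\<preceq>\<index>\<close> 50)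
  where "x \<preceq>\<^bsub>A\<^esub> y \<longleftrightarrow> x \<^bold>\<and>\<^bsub>A\<^esub> y = x"

locale fl_algebra = monoid A for A (structure) +
  assumes meet_closed: "\<lbrakk>x \<in> carrier A; y \<in> carrier A\<rbrakk> \<Longrightarrow> x \<^bold>\<and> y \<in> carrier A"
    and join_closed: "\<lbrakk>x \<in> carrier A; y \<in> carrier A\<rbrakk> \<Longrightarrow> x \<^bold>\<or> y \<in> carrier A"
    and ldiv_closed: "\<lbrakk>x \<in> carrier A; y \<in> carrier A\<rbrakk> \<Longrightarrow> x \<setminus> y \<in> carrier A"
    and rdiv_closed: "\<lbrakk>x \<in> carrier A; y \<in> carrier A\<rbrakk> \<Longrightarrow> x \<sslash> y \<in> carrier A"
    and zero_closed: "\<zero> \<in> carrier A"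
    and meet_commute: "\<lbrakk>x \<in> carrier A; y \<in> carrier A\<rbrakk> \<Longrightarrow> x \<^bold>\<and> y = y \<^bold>\<and> x"
    and join_commute: "\<lbrakk>x \<in> carrier A; y \<in> carrier A\<rbrakk> \<Longrightarrow> x \<^bold>\<or> y = y \<^bold>\<or> x"
    and meet_assoc: "\<lbrakk>x \<in> carrier A; y \<in> carrier A; z \<in> carrier A\<rbrakk>
          \<Longrightarrow> (x \<^bold>\<and> y) \<^bold>\<and> z = x \<^bold>\<and> (y \<^bold>\<and> z)"
    and join_assoc: "\<lbrakk>x \<in> carrier A; y \<in> carrier A; z \<in> carrier A\<rbrakk>
          \<Longrightarrow> (x \<^bold>\<or> y) \<^bold>\<or> z = x \<^bold>\<or> (y \<^bold>\<or> z)"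
    and meet_join_absorb: "\<lbrakk>x \<in> carrier A; y \<in> carrier A\<rbrakk> \<Longrightarrow> x \<^bold>\<and> (x \<^bold>\<or> y) = x"
    and join_meet_absorb: "\<lbrakk>x \<in> carrier A; y \<in> carrier A\<rbrakk> \<Longrightarrow> x \<^bold>\<or> (x \<^bold>\<and> y) = x"
    and residuation_ldiv: "\<lbrakk>x \<in> carrier A; y \<in> carrier A; z \<in> carrier A\<rbrakk>
          \<Longrightarrow> x \<otimes> y \<preceq> z \<longleftrightarrow> y \<preceq> x \<setminus> z"
    and residuation_rdiv: "\<lbrakk>x \<in> carrier A; y \<in> carrier A; z \<in> carrier A\<rbrakk>
          \<Longrightarrow> x \<otimes> y \<preceq> z \<longleftrightarrow> x \<preceq> z \<sslash> y"

locale pseudo_BL_algebra = fl_algebra +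
  assumes zero_le: "x \<in> carrier A \<Longrightarrow> \<zero> \<preceq> x"
    and le_one: "x \<in> carrier A \<Longrightarrow> x \<preceq> \<one>"
    and divisibility_left: "\<lbrakk>x \<in> carrier A; y \<in> carrier A\<rbrakk>
          \<Longrightarrow> x \<otimes> (x \<setminus> (x \<^bold>\<and> y)) = x \<^bold>\<and> y"
    and divisibility_right: "\<lbrakk>x \<in> carrier A; y \<in> carrier A\<rbrakk>
          \<Longrightarrow> ((x \<^bold>\<and> y) \<sslash> x) \<otimes> x = x \<^bold>\<and> y"
    and prelinearity_left: "\<lbrakk>x \<in> carrier A; y \<in> carrier A\<rbrakk>
          \<Longrightarrow> (x \<setminus> y) \<^bold>\<or> (y \<setminus> x) = \<one>"
    and prelinearity_right: "\<lbrakk>x \<in> carrier A; y \<in> carrier A\<rbrakk>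
          \<Longrightarrow> (y \<sslash> x) \<^bold>\<or> (x \<sslash> y) = \<one>"

locale pseudo_MV_algebra = pseudo_BL_algebra +
  assumes MV_left: "\<lbrakk>x \<in> carrier A; y \<in> carrier A\<rbrakk> \<Longrightarrow> x \<sslash> (y \<setminus> x) = x \<^bold>\<or> y"
    and MV_right: "\<lbrakk>x \<in> carrier A; y \<in> carrier A\<rbrakk> \<Longrightarrow> (x \<sslash> y) \<setminus> x = x \<^bold>\<or> y"

record 'a lgroup_sig = "'a monoid" +
  lg_le :: "'a \<Rightarrow> 'a \<Rightarrow> bool"

abbreviation lg_order :: "('a, 'b) lgroup_sig_scheme \<Rightarrow> 'a gorder"
  where "lg_order G \<equiv> \<lparr>carrier = carrier G, eq = (=), le = lg_le G\<rparr>"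

abbreviation lg_meet :: "('a, 'b) lgroup_sig_scheme \<Rightarrow> 'a \<Rightarrow> 'a \<Rightarrow> 'a"
  where "lg_meet G \<equiv> Lattice.meet (lg_order G)"

abbreviation lg_join :: "('a, 'b) lgroup_sig_scheme \<Rightarrow> 'a \<Rightarrow> 'a \<Rightarrow> 'a"
  where "lg_join G \<equiv> Lattice.join (lg_order G)"

locale l_group = group G for G (structure) +
  assumes lattice_order: "Lattice.lattice (lg_order G)"
    and mult_left_mono: "\<lbrakk>x \<in> carrier G; y \<in> carrier G; z \<in> carrier G; lg_le G x y\<rbrakk>
          \<Longrightarrow> lg_le G (z \<otimes> x) (z \<otimes> y)"
    and mult_right_mono: "\<lbrakk>x \<in> carrier G; y \<in> carrier G; z \<in> carrier G; lg_le G x y\<rbrakk>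
          \<Longrightarrow> lg_le G (x \<otimes> z) (y \<otimes> z)"

definition pos_cone :: "('a, 'b) lgroup_sig_scheme \<Rightarrow> 'a set"
  where "pos_cone G = {g \<in> carrier G. lg_le G \<one>\<^bsub>G\<^esub> g}"

definition neg_cone :: "('a, 'b) lgroup_sig_scheme \<Rightarrow> 'a set"
  where "neg_cone G = {g \<in> carrier G. lg_le G g \<one>\<^bsub>G\<^esub>}"

text \<open>
  The two summands are kept apart by the sum type: \<open>Inl f\<close> with
  \<open>f \<in> J \<rightarrow>\<^sub>E pos_cone G\<close> is the sequence \<open>\<langle>f\<^sub>j\<rangle>\<close>, and \<open>Inr x\<close> with
  \<open>x \<in> I \<rightarrow>\<^sub>E neg_cone G\<close> is the sequence \<open>\<langle>a\<^sub>i\<inverse>\<rangle>\<close>, where \<open>x i\<close> is the negative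
  element \<open>a\<^sub>i\<inverse>\<close> itself. Hence \<open>a\<^sub>i\<close> is \<open>inv (x i)\<close>, and \<open>(b\<^sub>i a\<^sub>i)\<inverse>\<close> is
  \<open>x i \<otimes> y i\<close> if \<open>x i = a\<^sub>i\<inverse>\<close> and \<open>y i = b\<^sub>i\<inverse>\<close>.
\<close>

type_synonym ('g, 'i, 'j) kite_elem = "('j \<Rightarrow> 'g) + ('i \<Rightarrow> 'g)"

definition kite_carrier ::
  "'i set \<Rightarrow> 'j set \<Rightarrow> ('g, 'b) lgroup_sig_scheme \<Rightarrow> ('g, 'i, 'j) kite_elem set"
  where "kite_carrier I J G = (J \<rightarrow>\<^sub>E pos_cone G) <+> (I \<rightarrow>\<^sub>E neg_cone G)"

fun kite_le :: "'i set \<Rightarrow> 'j set \<Rightarrow> ('g, 'b) lgroup_sig_scheme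
    \<Rightarrow> ('g, 'i, 'j) kite_elem \<Rightarrow> ('g, 'i, 'j) kite_elem \<Rightarrow> bool"
  where
    "kite_le I J G (Inl f) (Inl g) \<longleftrightarrow> (\<forall>j\<in>J. lg_le G (f j) (g j))"
  | "kite_le I J G (Inr x) (Inr y) \<longleftrightarrow> (\<forall>i\<in>I. lg_le G (x i) (y i))"
  | "kite_le I J G (Inl f) (Inr x) \<longleftrightarrow> True"
  | "kite_le I J G (Inr x) (Inl f) \<longleftrightarrow> False"

definition kite_order :: "'i set \<Rightarrow> 'j set \<Rightarrow> ('g, 'b) lgroup_sig_scheme
    \<Rightarrow> ('g, 'i, 'j) kite_elem gorder"
  where "kite_order I J G =
    \<lparr>carrier = kite_carrier I J G, eq = (=), le = kite_le I J G\<rparr>"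

definition kite_one :: "'i set \<Rightarrow> ('g, 'b) lgroup_sig_scheme \<Rightarrow> ('g, 'i, 'j) kite_elem"
  where "kite_one I G = Inr (\<lambda>i\<in>I. \<one>\<^bsub>G\<^esub>)"

definition kite_zero :: "'j set \<Rightarrow> ('g, 'b) lgroup_sig_scheme \<Rightarrow> ('g, 'i, 'j) kite_elem"
  where "kite_zero J G = Inl (\<lambda>j\<in>J. \<one>\<^bsub>G\<^esub>)"

fun kite_mult :: "'i set \<Rightarrow> 'j set \<Rightarrow> ('j \<Rightarrow> 'i) \<Rightarrow> ('j \<Rightarrow> 'i) \<Rightarrow> ('g, 'b) lgroup_sig_scheme
    \<Rightarrow> ('g, 'i, 'j) kite_elem \<Rightarrow> ('g, 'i, 'j) kite_elem \<Rightarrow> ('g, 'i, 'j) kite_elem"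
  where
    "kite_mult I J lam rho G (Inr x) (Inr y) = Inr (\<lambda>i\<in>I. x i \<otimes>\<^bsub>G\<^esub> y i)"
  | "kite_mult I J lam rho G (Inr x) (Inl f) =
       Inl (\<lambda>j\<in>J. lg_join G (x (lam j) \<otimes>\<^bsub>G\<^esub> f j) \<one>\<^bsub>G\<^esub>)"
  | "kite_mult I J lam rho G (Inl f) (Inr x) =
       Inl (\<lambda>j\<in>J. lg_join G (f j \<otimes>\<^bsub>G\<^esub> x (rho j)) \<one>\<^bsub>G\<^esub>)"
  | "kite_mult I J lam rho G (Inl f) (Inl g) = kite_zero J G"

fun kite_ldiv :: "'i set \<Rightarrow> 'j set \<Rightarrow> ('j \<Rightarrow> 'i) \<Rightarrow> ('j \<Rightarrow> 'i) \<Rightarrow> ('g, 'b) lgroup_sig_scheme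
    \<Rightarrow> ('g, 'i, 'j) kite_elem \<Rightarrow> ('g, 'i, 'j) kite_elem \<Rightarrow> ('g, 'i, 'j) kite_elem"
  where
    "kite_ldiv I J lam rho G (Inr x) (Inr y) =
       Inr (\<lambda>i\<in>I. lg_meet G (inv\<^bsub>G\<^esub> (x i) \<otimes>\<^bsub>G\<^esub> y i) \<one>\<^bsub>G\<^esub>)"
  | "kite_ldiv I J lam rho G (Inr x) (Inl f) =
       Inl (\<lambda>j\<in>J. inv\<^bsub>G\<^esub> (x (lam j)) \<otimes>\<^bsub>G\<^esub> f j)"
  | "kite_ldiv I J lam rho G (Inl f) (Inl g) =
       Inr (\<lambda>i\<in>I. if i \<in> rho ` J
                   then lg_meet G (inv\<^bsub>G\<^esub> (f (the_inv_into J rho i)) \<otimes>\<^bsub>G\<^esub> g (the_inv_into J rho i)) \<one>\<^bsub>G\<^esub>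
                   else \<one>\<^bsub>G\<^esub>)"
  | "kite_ldiv I J lam rho G (Inl f) (Inr x) = kite_one I G"

text \<open>As for \<open>/\<close>, the first argument of \<open>kite_rdiv\<close> is the numerator.\<close>

fun kite_rdiv :: "'i set \<Rightarrow> 'j set \<Rightarrow> ('j \<Rightarrow> 'i) \<Rightarrow> ('j \<Rightarrow> 'i) \<Rightarrow> ('g, 'b) lgroup_sig_scheme
    \<Rightarrow> ('g, 'i, 'j) kite_elem \<Rightarrow> ('g, 'i, 'j) kite_elem \<Rightarrow> ('g, 'i, 'j) kite_elem"
  where
    "kite_rdiv I J lam rho G (Inr y) (Inr x) =
       Inr (\<lambda>i\<in>I. lg_meet G (y i \<otimes>\<^bsub>G\<^esub> inv\<^bsub>G\<^esub> (x i)) \<one>\<^bsub>G\<^esub>)"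
  | "kite_rdiv I J lam rho G (Inl f) (Inr x) =
       Inl (\<lambda>j\<in>J. f j \<otimes>\<^bsub>G\<^esub> inv\<^bsub>G\<^esub> (x (rho j)))"
  | "kite_rdiv I J lam rho G (Inl g) (Inl f) =
       Inr (\<lambda>i\<in>I. if i \<in> lam ` J
                   then lg_meet G (g (the_inv_into J lam i) \<otimes>\<^bsub>G\<^esub> inv\<^bsub>G\<^esub> (f (the_inv_into J lam i))) \<one>\<^bsub>G\<^esub>
                   else \<one>\<^bsub>G\<^esub>)"
  | "kite_rdiv I J lam rho G (Inr x) (Inl f) = kite_one I G"

definition kite :: "'i set \<Rightarrow> 'j set \<Rightarrow> ('j \<Rightarrow> 'i) \<Rightarrow> ('j \<Rightarrow> 'i) \<Rightarrow> ('g, 'b) lgroup_sig_scheme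
    \<Rightarrow> ('g, 'i, 'j) kite_elem fl_sig"
  where "kite I J lam rho G =
    \<lparr>carrier = kite_carrier I J G,
     monoid.mult = kite_mult I J lam rho G,
     one = kite_one I G,
     fl_meet = Lattice.meet (kite_order I J G),
     fl_join = Lattice.join (kite_order I J G),
     fl_ldiv = kite_ldiv I J lam rho G,
     fl_rdiv = kite_rdiv I J lam rho G,
     fl_zero = kite_zero J G\<rparr>"

end

theory Submission
  imports Defs
begin

text \<open>
  Residuation, divisibility, prelinearity and the MV identities can be checked one coordinate at a
  time, where they become identities of the \<open>\<ell>\<close>-group; these follow from multiplication
  distributing over meets and joins and from inversion turning meets into joins. Prelinearity, for
  instance, is \<open>(x\<inverse> \<squnion> y\<inverse>) (x \<sqinter> y) = 1\<close>. For the pseudo BL axioms, injective \<open>lam\<close> and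
  \<open>rho\<close> suffice. Surjectivity matters only for the MV identities: \<open>f / (a \<setminus> f)\<close> has coordinate
  \<open>1\<close>, not \<open>a i\<close>, at every \<open>i\<close> outside the image of \<open>lam\<close>, and dually for \<open>rho\<close>.
\<close>

section \<open>Binary meets and joins in partial orders and lattices\<close>

lemma (in partial_order) greatest_Lower_pair_iff:
  assumes "x \<in> carrier L" "y \<in> carrier L"
  shows "greatest L m (Lower L {x, y}) \<longleftrightarrow>
    m \<in> carrier L \<and> m \<sqsubseteq> x \<and> m \<sqsubseteq> y \<and> (\<forall>z\<in>carrier L. z \<sqsubseteq> x \<longrightarrow> z \<sqsubseteq> y \<longrightarrow> z \<sqsubseteq> m)"
  using assms by (auto simp: greatest_def Lower_def)

lemma (in partial_order) least_Upper_pair_iff: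
  assumes "x \<in> carrier L" "y \<in> carrier L"
  shows "least L m (Upper L {x, y}) \<longleftrightarrow>
    m \<in> carrier L \<and> x \<sqsubseteq> m \<and> y \<sqsubseteq> m \<and> (\<forall>z\<in>carrier L. x \<sqsubseteq> z \<longrightarrow> y \<sqsubseteq> z \<longrightarrow> m \<sqsubseteq> z)"
  using assms by (auto simp: least_def Upper_def)

text \<open>\<open>meet\<close> is a choice among the greatest lower bounds, and antisymmetry leaves
  only one candidate.\<close>

lemma (in partial_order) meet_eqI:
  assumes "x \<in> carrier L" "y \<in> carrier L" "m \<in> carrier L" "m \<sqsubseteq> x" "m \<sqsubseteq> y"
    and "\<And>z. \<lbrakk>z \<in> carrier L; z \<sqsubseteq> x; z \<sqsubseteq> y\<rbrakk> \<Longrightarrow> z \<sqsubseteq> m"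
  shows "x \<sqinter> y = m"
  unfolding meet_def inf_def
  by (rule some_equality, use assms in \<open>simp add: greatest_Lower_pair_iff\<close>)
    (rule greatest_unique, assumption, use assms in \<open>simp add: greatest_Lower_pair_iff\<close>)

lemma (in partial_order) least_imp_join_eq:
  assumes "least L m (Upper L {x, y})"
  shows "x \<squnion> y = m"
  unfolding join_def sup_def
  using assms by (rule some_equality) (rule least_unique[OF _ assms])

lemma (in partial_order) join_eqI:
  assumes "x \<in> carrier L" "y \<in> carrier L" "m \<in> carrier L" "x \<sqsubseteq> m" "y \<sqsubseteq> m"
    and "\<And>z. \<lbrakk>z \<in> carrier L; x \<sqsubseteq> z; y \<sqsubseteq> z\<rbrakk> \<Longrightarrow> m \<sqsubseteq> z"
  shows "x \<squnion> y = m"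
  using assms by (intro least_imp_join_eq) (simp add: least_Upper_pair_iff)

context Lattice.lattice
begin

lemma le_meet_iff:
  assumes "x \<in> carrier L" "y \<in> carrier L" "z \<in> carrier L"
  shows "z \<sqsubseteq> x \<sqinter> y \<longleftrightarrow> z \<sqsubseteq> x \<and> z \<sqsubseteq> y"
  using assms by (meson le_trans meet_closed meet_le meet_left meet_right)

lemma join_le_iff:
  assumes "x \<in> carrier L" "y \<in> carrier L" "z \<in> carrier L"
  shows "x \<squnion> y \<sqsubseteq> z \<longleftrightarrow> x \<sqsubseteq> z \<and> y \<sqsubseteq> z"
  using assms by (meson le_trans join_closed join_le join_left join_right)

lemma meet_eq_left:
  "\<lbrakk>x \<in> carrier L; y \<in> carrier L; x \<sqsubseteq> y\<rbrakk> \<Longrightarrow> x \<sqinter> y = x"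
  \<comment> \<open>Here \<open>le_iff_join\<close> is the criterion by meets,
    \<open>x = x \<sqinter> y\<close>; the criterion by joins is \<open>le_iff_meet\<close>.\<close>
  using le_iff_join by fastforce

lemma join_eq_left:
  "\<lbrakk>x \<in> carrier L; y \<in> carrier L; y \<sqsubseteq> x\<rbrakk> \<Longrightarrow> x \<squnion> y = x"
  using le_iff_meet join_comm by metis

end

section \<open>Arithmetic of \<ell>-groups\<close>

context l_group
begin

sublocale order: Lattice.lattice "lg_order G"
  rewrites "carrier (lg_order G) = carrier G" and "gorder.le (lg_order G) = lg_le G"
  using lattice_order by auto

abbreviation lgle (infix \<open>\<le>\<^sub>g\<close> 50) where "x \<le>\<^sub>g y \<equiv> lg_le G x y"
abbreviation lgmeet (infixl \<open>\<sqinter>\<^sub>g\<close> 65) where "x \<sqinter>\<^sub>g y \<equiv> lg_meet G x y"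
abbreviation lgjoin (infixl \<open>\<squnion>\<^sub>g\<close> 65) where "x \<squnion>\<^sub>g y \<equiv> lg_join G x y"

lemma inv_mult_cancel [simp]:
  assumes "x \<in> carrier G" "y \<in> carrier G"
  shows "inv x \<otimes> (x \<otimes> y) = y" "x \<otimes> (inv x \<otimes> y) = y"
    "y \<otimes> x \<otimes> inv x = y" "y \<otimes> inv x \<otimes> x = y"
  using assms by (simp_all add: m_assoc[symmetric]) (simp_all add: m_assoc)

text \<open>Left translations by \<open>x\<close> and by \<open>inv x\<close> are monotone and
  inverse to each other. This is residuation in one coordinate, before truncation at
  \<open>\<one>\<close>.\<close>

lemma mult_le_iff_le_inv_mult:
  assumes "x \<in> carrier G" "y \<in> carrier G" "z \<in> carrier G"
  shows "x \<otimes> y \<le>\<^sub>g z \<longleftrightarrow> y \<le>\<^sub>g inv x \<otimes> z"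
proof
  show "x \<otimes> y \<le>\<^sub>g z \<Longrightarrow> y \<le>\<^sub>g inv x \<otimes> z"
    using mult_left_mono[of "x \<otimes> y" z "inv x"] assms by simp
  show "y \<le>\<^sub>g inv x \<otimes> z \<Longrightarrow> x \<otimes> y \<le>\<^sub>g z"
    using mult_left_mono[of y "inv x \<otimes> z" x] assms by simp
qed

lemma mult_le_iff_le_mult_inv:
  assumes "x \<in> carrier G" "y \<in> carrier G" "z \<in> carrier G"
  shows "x \<otimes> y \<le>\<^sub>g z \<longleftrightarrow> x \<le>\<^sub>g z \<otimes> inv y"
proof
  show "x \<otimes> y \<le>\<^sub>g z \<Longrightarrow> x \<le>\<^sub>g z \<otimes> inv y"
    using mult_right_mono[of "x \<otimes> y" z "inv y"] assms by simp
  show "x \<le>\<^sub>g z \<otimes> inv y \<Longrightarrow> x \<otimes> y \<le>\<^sub>g z"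
    using mult_right_mono[of x "z \<otimes> inv y" y] assms by simp
qed

lemma le_mult_iff_inv_mult_le:
  assumes "x \<in> carrier G" "y \<in> carrier G" "z \<in> carrier G"
  shows "z \<le>\<^sub>g x \<otimes> y \<longleftrightarrow> inv x \<otimes> z \<le>\<^sub>g y"
  using mult_le_iff_le_inv_mult[of "inv x" z y] assms by simp

lemma le_mult_iff_mult_inv_le:
  assumes "x \<in> carrier G" "y \<in> carrier G" "z \<in> carrier G"
  shows "z \<le>\<^sub>g x \<otimes> y \<longleftrightarrow> z \<otimes> inv y \<le>\<^sub>g x"
  using mult_le_iff_le_mult_inv[of z "inv y" x] assms by simp

lemma inv_le_iff:
  assumes "x \<in> carrier G" "y \<in> carrier G"
  shows "inv x \<le>\<^sub>g inv y \<longleftrightarrow> y \<le>\<^sub>g x"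
proof -
  have "y \<le>\<^sub>g x \<longleftrightarrow> inv x \<otimes> y \<le>\<^sub>g \<one>"
    using le_mult_iff_inv_mult_le[of x \<one> y] assms by simp
  then show ?thesis
    using mult_le_iff_le_mult_inv[of "inv x" y \<one>] assms by simp
qed

lemma inv_le_swap:
  assumes "x \<in> carrier G" "y \<in> carrier G"
  shows "inv x \<le>\<^sub>g y \<longleftrightarrow> inv y \<le>\<^sub>g x"
  using inv_le_iff[of x "inv y"] assms by simp

lemma le_inv_swap:
  assumes "x \<in> carrier G" "y \<in> carrier G"
  shows "x \<le>\<^sub>g inv y \<longleftrightarrow> y \<le>\<^sub>g inv x"
  using inv_le_iff[of "inv x" y] assms by simp

text \<open>Left translation is an order automorphism: a common lower bound of the two products is
  pulled back by \<open>inv x\<close> to a common lower bound of \<open>y\<close> and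
  \<open>z\<close>.\<close>

lemma mult_meet_distrib_left:
  assumes "x \<in> carrier G" "y \<in> carrier G" "z \<in> carrier G"
  shows "x \<otimes> (y \<sqinter>\<^sub>g z) = (x \<otimes> y) \<sqinter>\<^sub>g (x \<otimes> z)"
  using assms
  by (intro sym[OF order.meet_eqI])
    (auto simp: mult_left_mono order.meet_left order.meet_right le_mult_iff_inv_mult_le
      order.le_meet_iff)

lemma mult_meet_distrib_right:
  assumes "x \<in> carrier G" "y \<in> carrier G" "z \<in> carrier G"
  shows "(y \<sqinter>\<^sub>g z) \<otimes> x = (y \<otimes> x) \<sqinter>\<^sub>g (z \<otimes> x)"
  using assms
  by (intro sym[OF order.meet_eqI])
    (auto simp: mult_right_mono order.meet_left order.meet_right le_mult_iff_mult_inv_le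
      order.le_meet_iff)

lemma mult_join_distrib_left:
  assumes "x \<in> carrier G" "y \<in> carrier G" "z \<in> carrier G"
  shows "x \<otimes> (y \<squnion>\<^sub>g z) = (x \<otimes> y) \<squnion>\<^sub>g (x \<otimes> z)"
  using assms
  by (intro sym[OF order.join_eqI])
    (auto simp: mult_left_mono order.join_left order.join_right mult_le_iff_le_inv_mult
      order.join_le_iff)

lemma mult_join_distrib_right:
  assumes "x \<in> carrier G" "y \<in> carrier G" "z \<in> carrier G"
  shows "(y \<squnion>\<^sub>g z) \<otimes> x = (y \<otimes> x) \<squnion>\<^sub>g (z \<otimes> x)"
  using assms
  by (intro sym[OF order.join_eqI])
    (auto simp: mult_right_mono order.join_left order.join_right mult_le_iff_le_mult_inv
      order.join_le_iff)

text \<open>Inversion is an order-reversing involution, so it exchanges greatest lower and least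
  upper bounds.\<close>

lemma inv_meet:
  assumes "x \<in> carrier G" "y \<in> carrier G"
  shows "inv (x \<sqinter>\<^sub>g y) = inv x \<squnion>\<^sub>g inv y"
  using assms
  by (intro sym[OF order.join_eqI])
    (auto simp: inv_le_iff order.meet_left order.meet_right order.le_meet_iff inv_le_swap)

lemma join_ldiv_meet_one:
  assumes "x \<in> carrier G" "y \<in> carrier G"
  shows "(inv x \<otimes> y \<sqinter>\<^sub>g \<one>) \<squnion>\<^sub>g (inv y \<otimes> x \<sqinter>\<^sub>g \<one>) = \<one>"
proof -
  \<comment> \<open>Both terms acquire the common right factor
    \<open>x \<sqinter>\<^sub>g y\<close>, which then comes out of the join.\<close>
  have "inv x \<otimes> y \<sqinter>\<^sub>g \<one> = inv x \<otimes> (x \<sqinter>\<^sub>g y)" "inv y \<otimes> x \<sqinter>\<^sub>g \<one> = inv y \<otimes> (x \<sqinter>\<^sub>g y)"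
    using assms by (simp_all add: mult_meet_distrib_left meet_comm)
  then show ?thesis
    using assms by (simp add: mult_join_distrib_right[symmetric] inv_meet[symmetric])
qed

lemma join_rdiv_meet_one:
  assumes "x \<in> carrier G" "y \<in> carrier G"
  shows "(x \<otimes> inv y \<sqinter>\<^sub>g \<one>) \<squnion>\<^sub>g (y \<otimes> inv x \<sqinter>\<^sub>g \<one>) = \<one>"
proof -
  have "x \<otimes> inv y \<sqinter>\<^sub>g \<one> = (x \<sqinter>\<^sub>g y) \<otimes> inv y" "y \<otimes> inv x \<sqinter>\<^sub>g \<one> = (x \<sqinter>\<^sub>g y) \<otimes> inv x"
    using assms by (simp_all add: mult_meet_distrib_right meet_comm)
  then show ?thesis
    using assms
    by (simp add: mult_join_distrib_left[symmetric] inv_meet[symmetric] join_comm[of _ "inv y"])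
qed

text \<open>Inversion turns the truncated quotient into
  \<open>inv x \<otimes> y \<squnion>\<^sub>g \<one>\<close>, and multiplying by \<open>x\<close>
  clears the denominator. This is \<open>MV_left\<close> in one coordinate.\<close>

lemma rdiv_ldiv_meet_one:
  assumes "x \<in> carrier G" "y \<in> carrier G"
  shows "x \<otimes> inv (inv y \<otimes> x \<sqinter>\<^sub>g \<one>) = x \<squnion>\<^sub>g y"
  using assms
  by (simp add: inv_meet mult_join_distrib_left inv_mult_group m_assoc[symmetric] join_comm)

lemma ldiv_rdiv_meet_one:
  assumes "x \<in> carrier G" "y \<in> carrier G"
  shows "inv (x \<otimes> inv y \<sqinter>\<^sub>g \<one>) \<otimes> x = x \<squnion>\<^sub>g y"
  using assms
  by (simp add: inv_meet mult_join_distrib_right inv_mult_group m_assoc join_comm)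

text \<open>Distributing gives \<open>z \<sqinter>\<^sub>g x\<close>, which collapses because
  \<open>z\<close> lies below \<open>x\<close>. This is divisibility in one coordinate.\<close>

lemma mult_ldiv_meet_one:
  assumes "x \<in> carrier G" "z \<in> carrier G" "z \<le>\<^sub>g x"
  shows "x \<otimes> (inv x \<otimes> z \<sqinter>\<^sub>g \<one>) = z"
  using assms by (simp add: mult_meet_distrib_left order.meet_eq_left)

lemma rdiv_meet_one_mult:
  assumes "x \<in> carrier G" "z \<in> carrier G" "z \<le>\<^sub>g x"
  shows "(z \<otimes> inv x \<sqinter>\<^sub>g \<one>) \<otimes> x = z"
  using assms by (simp add: mult_meet_distrib_right order.meet_eq_left)

lemma join_one_eq_one: "\<lbrakk>x \<in> carrier G; x \<le>\<^sub>g \<one>\<rbrakk> \<Longrightarrow> x \<squnion>\<^sub>g \<one> = \<one>"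
  using order.le_iff_meet by simp

text \<open>The left side expands to the join of \<open>x \<otimes> y\<close>, \<open>y\<close> and
  \<open>\<one>\<close>, and \<open>\<one>\<close> absorbs \<open>y\<close>. So truncating an
  intermediate product at \<open>\<one>\<close> has no effect on the final one, as associativity of
  mixed kite products requires.\<close>

lemma join_one_mult_join_one:
  assumes "x \<in> carrier G" "y \<in> carrier G" "y \<le>\<^sub>g \<one>"
  shows "(x \<squnion>\<^sub>g \<one>) \<otimes> y \<squnion>\<^sub>g \<one> = x \<otimes> y \<squnion>\<^sub>g \<one>"
  using assms order.weak_join_assoc[of "x \<otimes> y" y \<one>]
  by (simp add: mult_join_distrib_right join_one_eq_one)

lemma mult_join_one_join_one:
  assumes "x \<in> carrier G" "y \<in> carrier G" "y \<le>\<^sub>g \<one>"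
  shows "y \<otimes> (x \<squnion>\<^sub>g \<one>) \<squnion>\<^sub>g \<one> = y \<otimes> x \<squnion>\<^sub>g \<one>"
  using assms order.weak_join_assoc[of "y \<otimes> x" y \<one>]
  by (simp add: mult_join_distrib_left join_one_eq_one)

lemma mult_le_one:
  assumes "x \<in> carrier G" "y \<in> carrier G" "x \<le>\<^sub>g \<one>" "y \<le>\<^sub>g \<one>"
  shows "x \<otimes> y \<le>\<^sub>g \<one>"
  using assms mult_right_mono[of x \<one> y] order.le_trans[of "x \<otimes> y" y \<one>] by simp

lemma one_le_mult:
  assumes "x \<in> carrier G" "y \<in> carrier G" "\<one> \<le>\<^sub>g x" "\<one> \<le>\<^sub>g y"
  shows "\<one> \<le>\<^sub>g x \<otimes> y"
  using assms mult_right_mono[of \<one> x y] order.le_trans[of \<one> y "x \<otimes> y"] by simp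

lemma one_le_inv_iff: "x \<in> carrier G \<Longrightarrow> \<one> \<le>\<^sub>g inv x \<longleftrightarrow> x \<le>\<^sub>g \<one>"
  using le_inv_swap[of \<one> x] by simp

lemma pos_coneI: "\<lbrakk>x \<in> carrier G; \<one> \<le>\<^sub>g x\<rbrakk> \<Longrightarrow> x \<in> pos_cone G"
  by (simp add: pos_cone_def)

lemma neg_coneI: "\<lbrakk>x \<in> carrier G; x \<le>\<^sub>g \<one>\<rbrakk> \<Longrightarrow> x \<in> neg_cone G"
  by (simp add: neg_cone_def)

lemma pos_coneD: "x \<in> pos_cone G \<Longrightarrow> x \<in> carrier G" "x \<in> pos_cone G \<Longrightarrow> \<one> \<le>\<^sub>g x"
  by (auto simp: pos_cone_def)

lemma neg_coneD: "x \<in> neg_cone G \<Longrightarrow> x \<in> carrier G" "x \<in> neg_cone G \<Longrightarrow> x \<le>\<^sub>g \<one>"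
  by (auto simp: neg_cone_def)

end

section \<open>Carrier and order of the kite\<close>

locale kite_data = l_group G for G (structure) +
  fixes I :: "'i set" and J :: "'j set" and lam rho :: "'j \<Rightarrow> 'i"
  assumes inj_lam: "inj_on lam J" and inj_rho: "inj_on rho J"
    and lam_closed: "j \<in> J \<Longrightarrow> lam j \<in> I" and rho_closed: "j \<in> J \<Longrightarrow> rho j \<in> I"
begin

abbreviation K where "K \<equiv> kite I J lam rho G"
abbreviation P where "P \<equiv> J \<rightarrow>\<^sub>E pos_cone G"
abbreviation N where "N \<equiv> I \<rightarrow>\<^sub>E neg_cone G"

lemma mem_kite_carrier [simp]:
  "Inl f \<in> kite_carrier I J G \<longleftrightarrow> f \<in> P" "Inr x \<in> kite_carrier I J G \<longleftrightarrow> x \<in> N"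
  by (auto simp: kite_carrier_def)

lemma kite_cases [consumes 1, case_names Inl Inr]:
  assumes "x \<in> kite_carrier I J G"
  obtains f where "x = Inl f" "f \<in> P" | a where "x = Inr a" "a \<in> N"
  using assms by (cases x) auto

lemma kite_order_sel [simp]:
  "carrier (kite_order I J G) = kite_carrier I J G"
  "eq (kite_order I J G) = (=)"
  "gorder.le (kite_order I J G) = kite_le I J G"
  by (simp_all add: kite_order_def)

lemma P_closed [simp]: "\<lbrakk>f \<in> P; j \<in> J\<rbrakk> \<Longrightarrow> f j \<in> carrier G"
  and P_pos [simp]: "\<lbrakk>f \<in> P; j \<in> J\<rbrakk> \<Longrightarrow> \<one> \<le>\<^sub>g f j"
  by (auto dest: PiE_mem pos_coneD)

lemma N_closed [simp]: "\<lbrakk>a \<in> N; i \<in> I\<rbrakk> \<Longrightarrow> a i \<in> carrier G"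
  and N_neg [simp]: "\<lbrakk>a \<in> N; i \<in> I\<rbrakk> \<Longrightarrow> a i \<le>\<^sub>g \<one>"
  by (auto dest: PiE_mem neg_coneD)

text \<open>Members of \<open>P\<close> and restrictions to \<open>J\<close> are both
  \<open>undefined\<close> outside \<open>J\<close>, so agreement on \<open>J\<close> already gives
  equality of functions.\<close>

lemma restrict_P_eq: "f \<in> P \<Longrightarrow> (\<And>j. j \<in> J \<Longrightarrow> h j = f j) \<Longrightarrow> restrict h J = f"
  by (metis PiE_restrict restrict_ext)

lemma restrict_N_eq: "a \<in> N \<Longrightarrow> (\<And>i. i \<in> I \<Longrightarrow> h i = a i) \<Longrightarrow> restrict h I = a"
  by (metis PiE_restrict restrict_ext)

lemma kite_le_refl: "x \<in> kite_carrier I J G \<Longrightarrow> kite_le I J G x x"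
  by (erule kite_cases) simp_all

lemma kite_le_antisym:
  assumes "kite_le I J G x y" "kite_le I J G y x"
    and "x \<in> kite_carrier I J G" "y \<in> kite_carrier I J G"
  shows "x = y"
  using assms
  by (elim kite_cases) (simp_all, (metis PiE_ext order.le_antisym P_closed N_closed)+)

lemma kite_le_trans:
  assumes "kite_le I J G x y" "kite_le I J G y z"
    and "x \<in> kite_carrier I J G" "y \<in> kite_carrier I J G" "z \<in> kite_carrier I J G"
  shows "kite_le I J G x z"
  using assms
  by (elim kite_cases) (simp_all, (metis order.le_trans P_closed N_closed)+)

sublocale kite: partial_order "kite_order I J G"
  rewrites "carrier (kite_order I J G) = kite_carrier I J G"
    and "gorder.le (kite_order I J G) = kite_le I J G"
proof -
  show "partial_order (kite_order I J G)"
    by (unfold_locales, unfold kite_order_sel)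
      (simp | (rule kite_le_refl kite_le_antisym kite_le_trans; assumption))+
qed simp_all

section \<open>Lattice structure of the kite\<close>

lemma greatest_Inl_Inl:
  assumes "f \<in> P" "g \<in> P"
  shows "greatest (kite_order I J G) (Inl (\<lambda>j\<in>J. f j \<sqinter>\<^sub>g g j))
    (Lower (kite_order I J G) {Inl f, Inl g})"
  using assms
  by (subst kite.greatest_Lower_pair_iff)
    (auto intro!: pos_coneI elim!: kite_cases simp: order.meet_left order.meet_right order.le_meet_iff)

text \<open>Lower bounds of the form \<open>Inl f\<close> also exist here, but they lie below every
  \<open>Inr\<close> element and so do not compete with the coordinatewise meet. Dually,
  \<open>Inr\<close> upper bounds of two \<open>Inl\<close> elements lie above their coordinatewise
  join.\<close>

lemma greatest_Inr_Inr:
  assumes "a \<in> N" "b \<in> N"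
  shows "greatest (kite_order I J G) (Inr (\<lambda>i\<in>I. a i \<sqinter>\<^sub>g b i))
    (Lower (kite_order I J G) {Inr a, Inr b})"
  using assms
  by (subst kite.greatest_Lower_pair_iff)
    (auto intro!: neg_coneI elim!: kite_cases
      intro: order.le_trans[OF order.meet_left N_neg]
      simp: order.meet_left order.meet_right order.le_meet_iff)

lemma least_Inl_Inl:
  assumes "f \<in> P" "g \<in> P"
  shows "least (kite_order I J G) (Inl (\<lambda>j\<in>J. f j \<squnion>\<^sub>g g j))
    (Upper (kite_order I J G) {Inl f, Inl g})"
  using assms
  by (subst kite.least_Upper_pair_iff)
    (auto intro!: pos_coneI elim!: kite_cases
      intro: order.le_trans[OF P_pos order.join_left]
      simp: order.join_left order.join_right order.join_le_iff)

lemma least_Inr_Inr: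
  assumes "a \<in> N" "b \<in> N"
  shows "least (kite_order I J G) (Inr (\<lambda>i\<in>I. a i \<squnion>\<^sub>g b i))
    (Upper (kite_order I J G) {Inr a, Inr b})"
  using assms
  by (subst kite.least_Upper_pair_iff)
    (auto intro!: neg_coneI elim!: kite_cases
      simp: order.join_left order.join_right order.join_le_iff)

sublocale kite: Lattice.lattice "kite_order I J G"
  rewrites "carrier (kite_order I J G) = kite_carrier I J G"
    and "gorder.le (kite_order I J G) = kite_le I J G"
proof -
  \<comment> \<open>Elements of different summands are always comparable, so the smaller one is
    their meet and the larger one their join. Only pairs from one summand need the coordinatewise
    bounds.\<close>
  have comparable: "greatest (kite_order I J G) x (Lower (kite_order I J G) {x, y})"
      "least (kite_order I J G) y (Upper (kite_order I J G) {x, y})"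
    if "x \<in> kite_carrier I J G" "y \<in> kite_carrier I J G" "kite_le I J G x y" for x y
    using that
    by (simp_all add: kite.greatest_Lower_pair_iff kite.least_Upper_pair_iff kite_le_refl)
  show "Lattice.lattice (kite_order I J G)"
  proof (unfold_locales, unfold kite_order_sel)
    fix x y
    assume x: "x \<in> kite_carrier I J G" and y: "y \<in> kite_carrier I J G"
    show "\<exists>s. least (kite_order I J G) s (Upper (kite_order I J G) {x, y})"
      using x
    proof (cases rule: kite_cases)
      case (Inl f)
      from y show ?thesis
        by (cases rule: kite_cases) (use x y Inl comparable(2)[of x y] in \<open>auto intro: least_Inl_Inl\<close>)
    next
      case (Inr a)
      from y show ?thesis
        by (cases rule: kite_cases)
          (use x y Inr comparable(2)[of y x] in \<open>auto intro: least_Inr_Inr simp: insert_commute\<close>)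
    qed
    show "\<exists>s. greatest (kite_order I J G) s (Lower (kite_order I J G) {x, y})"
      using x
    proof (cases rule: kite_cases)
      case (Inl f)
      from y show ?thesis
        by (cases rule: kite_cases) (use x y Inl comparable(1)[of x y] in \<open>auto intro: greatest_Inl_Inl\<close>)
    next
      case (Inr a)
      from y show ?thesis
        by (cases rule: kite_cases)
          (use x y Inr comparable(1)[of y x] in \<open>auto intro: greatest_Inr_Inr simp: insert_commute\<close>)
    qed
  qed
qed simp_all

abbreviation kmeet (infixl \<open>\<sqinter>\<^sub>k\<close> 65) where "x \<sqinter>\<^sub>k y \<equiv> Lattice.meet (kite_order I J G) x y"
abbreviation kjoin (infixl \<open>\<squnion>\<^sub>k\<close> 65) where "x \<squnion>\<^sub>k y \<equiv> Lattice.join (kite_order I J G) x y"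

text \<open>Prelinearity and the MV identities need joins in coordinates. Meets get no such table,
  since divisibility uses only that \<open>x \<sqinter>\<^sub>k y\<close> lies below
  \<open>x\<close>.\<close>

lemma kite_join_simps:
  "\<lbrakk>f \<in> P; g \<in> P\<rbrakk> \<Longrightarrow> Inl f \<squnion>\<^sub>k Inl g = Inl (\<lambda>j\<in>J. f j \<squnion>\<^sub>g g j)"
  "\<lbrakk>a \<in> N; b \<in> N\<rbrakk> \<Longrightarrow> Inr a \<squnion>\<^sub>k Inr b = Inr (\<lambda>i\<in>I. a i \<squnion>\<^sub>g b i)"
  "\<lbrakk>f \<in> P; b \<in> N\<rbrakk> \<Longrightarrow> Inl f \<squnion>\<^sub>k Inr b = Inr b"
  "\<lbrakk>a \<in> N; g \<in> P\<rbrakk> \<Longrightarrow> Inr a \<squnion>\<^sub>k Inl g = Inr a"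
proof -
  show "Inl f \<squnion>\<^sub>k Inl g = Inl (\<lambda>j\<in>J. f j \<squnion>\<^sub>g g j)" if "f \<in> P" "g \<in> P" for f g
    by (rule kite.least_imp_join_eq[OF least_Inl_Inl[OF that]])
  show "Inr a \<squnion>\<^sub>k Inr b = Inr (\<lambda>i\<in>I. a i \<squnion>\<^sub>g b i)" if "a \<in> N" "b \<in> N" for a b
    by (rule kite.least_imp_join_eq[OF least_Inr_Inr[OF that]])
  show "Inr a \<squnion>\<^sub>k Inl f = Inr a" if "f \<in> P" "a \<in> N" for f a
    using that by (simp add: kite.join_eq_left)
  then show "Inl f \<squnion>\<^sub>k Inr a = Inr a" if "f \<in> P" "a \<in> N" for f a
    using that by (metis join_comm)
qed

section \<open>Monoid structure and residuation of the kite\<close>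

lemma kite_sel [simp]:
  "carrier K = kite_carrier I J G" "mult K = kite_mult I J lam rho G" "one K = kite_one I G"
  "fl_meet K = Lattice.meet (kite_order I J G)" "fl_join K = Lattice.join (kite_order I J G)"
  "fl_ldiv K = kite_ldiv I J lam rho G" "fl_rdiv K = kite_rdiv I J lam rho G"
  "fl_zero K = kite_zero J G"
  by (simp_all add: kite_def)

text \<open>Carries the order that the algebra defines through its meet back to
  \<open>kite_le\<close>, which can be evaluated by cases on the summands.\<close>

lemma kite_fl_le_iff:
  "\<lbrakk>x \<in> kite_carrier I J G; y \<in> kite_carrier I J G\<rbrakk> \<Longrightarrow> x \<preceq>\<^bsub>K\<^esub> y \<longleftrightarrow> kite_le I J G x y"
  using kite.le_iff_join by (auto simp: fl_le_def)

lemma kite_one_closed: "kite_one I G \<in> kite_carrier I J G"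
  by (auto simp: kite_one_def intro!: neg_coneI)

lemma kite_zero_closed: "kite_zero J G \<in> kite_carrier I J G"
  by (auto simp: kite_zero_def intro!: pos_coneI)

lemma kite_le_one: "x \<in> kite_carrier I J G \<Longrightarrow> kite_le I J G x (kite_one I G)"
  by (auto simp: kite_one_def elim!: kite_cases)

lemma kite_zero_le: "x \<in> kite_carrier I J G \<Longrightarrow> kite_le I J G (kite_zero J G) x"
  by (auto simp: kite_zero_def elim!: kite_cases)

lemma kite_mult_closed:
  assumes "x \<in> kite_carrier I J G" "y \<in> kite_carrier I J G"
  shows "kite_mult I J lam rho G x y \<in> kite_carrier I J G"
  using assms
  by (elim kite_cases)
    (auto intro!: pos_coneI neg_coneI kite_zero_closed mult_le_one
      simp: order.join_right lam_closed rho_closed)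

text \<open>Quotients in the upper summand are truncated at \<open>\<one>\<close> or equal to it.
  Dividing an \<open>Inl\<close> by an \<open>Inr\<close> element multiplies two elements above
  \<open>\<one>\<close>, so it stays in the positive cone without truncation.\<close>

lemma kite_ldiv_closed:
  assumes "x \<in> kite_carrier I J G" "y \<in> kite_carrier I J G"
  shows "kite_ldiv I J lam rho G x y \<in> kite_carrier I J G"
  using assms
  by (elim kite_cases)
    (auto intro!: pos_coneI neg_coneI kite_one_closed one_le_mult
      simp: order.meet_right one_le_inv_iff lam_closed the_inv_into_f_f[OF inj_rho])

lemma kite_rdiv_closed:
  assumes "x \<in> kite_carrier I J G" "y \<in> kite_carrier I J G"
  shows "kite_rdiv I J lam rho G x y \<in> kite_carrier I J G"
  using assms
  by (elim kite_cases)
    (auto intro!: pos_coneI neg_coneI kite_one_closed one_le_mult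
      simp: order.meet_right one_le_inv_iff rho_closed the_inv_into_f_f[OF inj_lam])

lemma kite_mult_one:
  assumes "x \<in> kite_carrier I J G"
  shows "kite_mult I J lam rho G x (kite_one I G) = x"
    and "kite_mult I J lam rho G (kite_one I G) x = x"
  using assms
  by (auto elim!: kite_cases intro!: restrict_P_eq restrict_N_eq
      simp: kite_one_def lam_closed rho_closed order.join_eq_left)

text \<open>With at least two \<open>Inl\<close> factors both sides are zero, because multiplying
  zero by a negative sequence and truncating gives zero again. With exactly one, the inner
  truncations disappear by \<open>join_one_mult_join_one\<close> and its mirror image.\<close>

lemma kite_mult_assoc:
  assumes "x \<in> kite_carrier I J G" "y \<in> kite_carrier I J G" "z \<in> kite_carrier I J G"
  shows "kite_mult I J lam rho G (kite_mult I J lam rho G x y) z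
    = kite_mult I J lam rho G x (kite_mult I J lam rho G y z)"
  using assms
  by (elim kite_cases)
    (auto intro!: restrict_ext simp: kite_zero_def lam_closed rho_closed m_assoc
      join_one_mult_join_one mult_join_one_join_one join_one_eq_one)

lemma Inr_le_ldiv_Inl_iff:
  assumes "a \<in> N" "f \<in> P" "g \<in> P"
  shows "kite_le I J G (Inr a) (kite_ldiv I J lam rho G (Inl f) (Inl g))
    \<longleftrightarrow> (\<forall>j\<in>J. a (rho j) \<le>\<^sub>g inv (f j) \<otimes> g j)" (is "?L \<longleftrightarrow> ?R")
proof
  assume ?L
  then show ?R
    using assms
    by (auto simp: rho_closed the_inv_into_f_f[OF inj_rho] order.le_meet_iff dest!: bspec[OF _ rho_closed])
next
  assume ?R
  then show ?L
    using assms by (auto simp: rho_closed the_inv_into_f_f[OF inj_rho] order.le_meet_iff)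
qed

lemma Inr_le_rdiv_Inl_iff:
  assumes "a \<in> N" "f \<in> P" "g \<in> P"
  shows "kite_le I J G (Inr a) (kite_rdiv I J lam rho G (Inl g) (Inl f))
    \<longleftrightarrow> (\<forall>j\<in>J. a (lam j) \<le>\<^sub>g g j \<otimes> inv (f j))" (is "?L \<longleftrightarrow> ?R")
proof
  assume ?L
  then show ?R
    using assms
    by (auto simp: lam_closed the_inv_into_f_f[OF inj_lam] order.le_meet_iff dest!: bspec[OF _ lam_closed])
next
  assume ?R
  then show ?L
    using assms by (auto simp: lam_closed the_inv_into_f_f[OF inj_lam] order.le_meet_iff)
qed

lemma kite_residuation_ldiv:
  assumes "x \<in> kite_carrier I J G" "y \<in> kite_carrier I J G" "z \<in> kite_carrier I J G"
  shows "kite_le I J G (kite_mult I J lam rho G x y) z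
    \<longleftrightarrow> kite_le I J G y (kite_ldiv I J lam rho G x z)"
  using assms
  \<comment> \<open>Unfolding the quotient of two \<open>Inl\<close> elements is blocked so that
    \<open>Inr_le_ldiv_Inl_iff\<close> can apply. The final \<open>simp\<close> permits it again for
    three \<open>Inl\<close> arguments, where it matters only that the quotient lies in the upper
    summand.\<close>
  by (elim kite_cases)
    (simp_all add: kite_zero_def kite_one_def lam_closed rho_closed order.le_meet_iff
      order.join_le_iff mult_le_iff_le_inv_mult Inr_le_ldiv_Inl_iff
      del: kite_ldiv.simps(3) cong: ball_cong, simp)

lemma kite_residuation_rdiv:
  assumes "x \<in> kite_carrier I J G" "y \<in> kite_carrier I J G" "z \<in> kite_carrier I J G"
  shows "kite_le I J G (kite_mult I J lam rho G x y) z
    \<longleftrightarrow> kite_le I J G x (kite_rdiv I J lam rho G z y)"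
  using assms
  by (elim kite_cases)
    (simp_all add: kite_zero_def kite_one_def lam_closed rho_closed order.le_meet_iff
      order.join_le_iff mult_le_iff_le_mult_inv Inr_le_rdiv_Inl_iff
      del: kite_rdiv.simps(3) cong: ball_cong, simp)

section \<open>Divisibility and prelinearity\<close>

text \<open>Here \<open>z\<close> stands for \<open>x \<sqinter>\<^sub>k y\<close>. The bound by
  \<open>x\<close> excludes \<open>x\<close> in the lower and \<open>z\<close> in the upper summand;
  when \<open>z\<close> is an \<open>Inl\<close> element, the truncation in the product leaves its
  coordinates unchanged, as they are above \<open>\<one>\<close>.\<close>

lemma kite_mult_ldiv:
  assumes "x \<in> kite_carrier I J G" "z \<in> kite_carrier I J G" "kite_le I J G z x"
  shows "kite_mult I J lam rho G x (kite_ldiv I J lam rho G x z) = z"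
  using assms
  by (elim kite_cases)
    (auto intro!: restrict_P_eq restrict_N_eq simp: lam_closed rho_closed kite_one_def
      the_inv_into_f_f[OF inj_rho] mult_ldiv_meet_one order.join_eq_left)

lemma kite_rdiv_mult:
  assumes "x \<in> kite_carrier I J G" "z \<in> kite_carrier I J G" "kite_le I J G z x"
  shows "kite_mult I J lam rho G (kite_rdiv I J lam rho G z x) x = z"
  using assms
  by (elim kite_cases)
    (auto intro!: restrict_P_eq restrict_N_eq simp: lam_closed rho_closed kite_one_def
      the_inv_into_f_f[OF inj_lam] rdiv_meet_one_mult order.join_eq_left)

lemma kite_prelinearity_ldiv:
  assumes "x \<in> kite_carrier I J G" "y \<in> kite_carrier I J G"
  shows "kite_ldiv I J lam rho G x y \<squnion>\<^sub>k kite_ldiv I J lam rho G y x = kite_one I G"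
  \<comment> \<open>The closure facts supply the membership premises of
    \<open>kite_join_simps\<close> for the two quotients. In the mixed cases one quotient is the
    unit and absorbs the other.\<close>
  using assms kite_ldiv_closed[OF assms] kite_ldiv_closed[OF assms(2,1)] kite_one_closed
  by (elim kite_cases)
    (auto intro!: restrict_ext simp: kite_join_simps kite_one_def
      the_inv_into_f_f[OF inj_rho] join_ldiv_meet_one order.join_eq_left)

lemma kite_prelinearity_rdiv:
  assumes "x \<in> kite_carrier I J G" "y \<in> kite_carrier I J G"
  shows "kite_rdiv I J lam rho G y x \<squnion>\<^sub>k kite_rdiv I J lam rho G x y = kite_one I G"
  using assms kite_rdiv_closed[OF assms] kite_rdiv_closed[OF assms(2,1)] kite_one_closed
  by (elim kite_cases)
    (auto intro!: restrict_ext simp: kite_join_simps kite_one_def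
      the_inv_into_f_f[OF inj_lam] join_rdiv_meet_one order.join_eq_left)

theorem pseudo_BL_kite: "pseudo_BL_algebra K"
proof (unfold_locales, unfold kite_sel)
  fix x y z
  assume x: "x \<in> kite_carrier I J G" and y: "y \<in> kite_carrier I J G"
    and z: "z \<in> kite_carrier I J G"
  show "x \<sqinter>\<^sub>k y \<sqinter>\<^sub>k z = x \<sqinter>\<^sub>k (y \<sqinter>\<^sub>k z)" "x \<squnion>\<^sub>k y \<squnion>\<^sub>k z = x \<squnion>\<^sub>k (y \<squnion>\<^sub>k z)"
    using kite.weak_meet_assoc[OF x y z] kite.weak_join_assoc[OF x y z] by simp_all
  show "kite_mult I J lam rho G x y \<preceq>\<^bsub>K\<^esub> z \<longleftrightarrow> y \<preceq>\<^bsub>K\<^esub> kite_ldiv I J lam rho G x z"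
    "kite_mult I J lam rho G x y \<preceq>\<^bsub>K\<^esub> z \<longleftrightarrow> x \<preceq>\<^bsub>K\<^esub> kite_rdiv I J lam rho G z y"
    \<comment> \<open>Both residuation laws have the same left side, so the second is used from
      right to left to avoid competing rewrites.\<close>
    using x y z
    by (simp_all add: kite_fl_le_iff kite_mult_closed kite_ldiv_closed kite_rdiv_closed
        kite_residuation_ldiv flip: kite_residuation_rdiv)
  show "kite_mult I J lam rho G (kite_mult I J lam rho G x y) z
    = kite_mult I J lam rho G x (kite_mult I J lam rho G y z)"
    by (rule kite_mult_assoc[OF x y z])
next
  fix x y
  assume x: "x \<in> kite_carrier I J G" and y: "y \<in> kite_carrier I J G"
  show "x \<sqinter>\<^sub>k (x \<squnion>\<^sub>k y) = x"
    using x y by (simp add: kite.meet_eq_left kite.join_left)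
  show "x \<squnion>\<^sub>k (x \<sqinter>\<^sub>k y) = x"
    using x y by (simp add: kite.join_eq_left kite.meet_left)
  show "kite_mult I J lam rho G x (kite_ldiv I J lam rho G x (x \<sqinter>\<^sub>k y)) = x \<sqinter>\<^sub>k y"
    "kite_mult I J lam rho G (kite_rdiv I J lam rho G (x \<sqinter>\<^sub>k y) x) x = x \<sqinter>\<^sub>k y"
    using x y by (simp_all add: kite_mult_ldiv kite_rdiv_mult kite.meet_left)
qed (simp_all add: kite_one_closed kite_zero_closed kite_mult_closed kite_ldiv_closed
    kite_rdiv_closed kite_mult_one kite_fl_le_iff kite_le_one kite_zero_le meet_comm join_comm
    kite_prelinearity_ldiv kite_prelinearity_rdiv)

section \<open>The MV identities\<close>

text \<open>Within one summand this is \<open>rdiv_ldiv_meet_one\<close> in each coordinate; in the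
  upper one the outer truncation is harmless because a join of negative elements is negative. For
  \<open>x = Inl f\<close> and \<open>y = Inr a\<close>, the coordinate at \<open>lam j\<close> is
  \<open>f j \<otimes> inv (inv (a (lam j)) \<otimes> f j)\<close> truncated at
  \<open>\<one>\<close>, hence \<open>a (lam j)\<close>, and \<open>lam\<close> reaches every
  index.\<close>

lemma kite_rdiv_ldiv:
  assumes "x \<in> kite_carrier I J G" "y \<in> kite_carrier I J G" and "I \<subseteq> lam ` J"
  shows "kite_rdiv I J lam rho G x (kite_ldiv I J lam rho G y x) = x \<squnion>\<^sub>k y"
  using assms
  by (elim kite_cases)
    (auto intro!: restrict_ext restrict_N_eq simp: kite_join_simps kite_one_def rho_closed
      lam_closed the_inv_into_f_f[OF inj_rho] the_inv_into_f_f[OF inj_lam]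
      subsetD[OF assms(3)] the_inv_into_into[OF inj_lam] f_the_inv_into_f[OF inj_lam]
      rdiv_ldiv_meet_one inv_mult_group order.meet_eq_left order.join_le_iff)

text \<open>Mirror image of the preceding argument: the mixed case now recovers
  \<open>a (rho j)\<close>, so the indices are reached through \<open>rho\<close>.\<close>

lemma kite_ldiv_rdiv:
  assumes "x \<in> kite_carrier I J G" "y \<in> kite_carrier I J G" and "I \<subseteq> rho ` J"
  shows "kite_ldiv I J lam rho G (kite_rdiv I J lam rho G x y) x = x \<squnion>\<^sub>k y"
  using assms
  by (elim kite_cases)
    (auto intro!: restrict_ext restrict_N_eq simp: kite_join_simps kite_one_def rho_closed
      lam_closed the_inv_into_f_f[OF inj_rho] the_inv_into_f_f[OF inj_lam]
      subsetD[OF assms(3)] the_inv_into_into[OF inj_rho] f_the_inv_into_f[OF inj_rho]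
      ldiv_rdiv_meet_one inv_mult_group order.meet_eq_left order.join_le_iff)

theorem pseudo_MV_kite:
  assumes "I \<subseteq> lam ` J" "I \<subseteq> rho ` J"
  shows "pseudo_MV_algebra K"
proof -
  interpret pseudo_BL_algebra K
    by (rule pseudo_BL_kite)
  show ?thesis
    by unfold_locales (simp_all add: kite_rdiv_ldiv kite_ldiv_rdiv assms)
qed

end

theorem lemma3p3:
  fixes G :: "('g, 'b) lgroup_sig_scheme"
    and I :: "'i set" and J :: "'j set"
    and lam rho :: "'j \<Rightarrow> 'i"
  assumes "l_group G"
    and "I \<approx> J"
    and "bij_betw lam J I" and "bij_betw rho J I"
  shows "pseudo_MV_algebra (kite I J lam rho G)"
proof -
  interpret l_group G
    by fact
  interpret kite_data G I J lam rho
    using assms(3,4) by unfold_locales (auto simp: bij_betw_def)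
  show ?thesis
    using assms(3,4) by (intro pseudo_MV_kite) (auto simp: bij_betw_def)
qed

end
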